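(* Let $Q=\{(x,y,z)\in\mathbb{R}^3 : x^2/a+y^2/b+z^2/c=1\}$ with $0<c<b<a$, and consider nonsingular periodic billiard trajectories inside $Q$. Assume the following conjecture: the winding numbers $m_0,m_1,m_2$ of every nonsingular periodic billiard trajectory inside $Q$ satisfy $m_2<m_1<m_0$. Then every periodic billiard trajectory inside $Q$ whose caustics are of type EH1, H1H1, EH2, and H1H2 has period at least five, four, five, and six, respectively.
   Context: The confocal family is $Q_\lambda=\{x^2/(a-\lambda)+y^2/(b-\lambda)+z^2/(c-\lambda)=1\}$. Every line of a billiard trajectory inside $Q$ is tangent to the same two confocal quadrics $Q_{\lambda_1},Q_{\lambda_2}$ (the caustics), $\lambda_1<\lambda_2$. The trajectory is nonsingular when $\lambda_1,\lambda_2\notin\{a,b,c\}$ and $0<\lambda_1<\lambda_2$. $Q_\lambda$ is an ellipsoid (E) for $\lambda\in(0,c)$, a one-sheet hyperboloid (H1) for $\lambda\in(c,b)$, a two-sheet hyperboloid (H2) for $\lambda\in(b,a)$; the type of the trajectory is the pair of caustic types (EH1: $\lambda_1\in(0,c),\lambda_2\in(c,b)$; H1H1: $c<\lambda_1<\lambda_2<b$; EH2: $\lambda_1\in(0,c),\lambda_2\in(b,a)$; H1H2: $\lambda_1\in(c,b),\lambda_2\in(b,a)$). Winding numbers: order $\{a,b,c,\lambda_1,\lambda_2\}$ as $c_1<\dots<c_5$, set $c_0=0$, and let $Q_{c_0}=Q$, $Q_a,Q_b,Q_c$ be the coordinate planes $x=0$, $y=0$, $z=0$ respectively. A nonsingular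 periodic trajectory has winding numbers $m_0,m_1,m_2$ if along one period it has exactly $m_j$ points on $Q_{c_{2j}}$ and $m_j$ points on $Q_{c_{2j+1}}$ (impacts with $Q$, tangencies with caustics, crossings of coordinate planes); $m_0$ is the period. *)

theory Defs
  imports "HOL-Analysis.Analysis"
begin

definition confocal :: "real \<Rightarrow> real \<Rightarrow> real \<Rightarrow> real \<Rightarrow> (real^3) set" where
  "confocal a b c l = {x. (x$1)^2/(a-l) + (x$2)^2/(b-l) + (x$3)^2/(c-l) = 1}"

definition normalQ :: "real \<Rightarrow> real \<Rightarrow> real \<Rightarrow> real^3 \<Rightarrow> real^3" where
  "normalQ a b c x = vector [x$1/a, x$2/b, x$3/c]"

definition billiard_traj :: "real \<Rightarrow> real \<Rightarrow> real \<Rightarrow> (nat \<Rightarrow> real^3) \<Rightarrow> bool" where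
  "billiard_traj a b c p \<longleftrightarrow>
     (\<forall>i. p i \<in> confocal a b c 0) \<and> (\<forall>i. p (Suc i) \<noteq> p i) \<and>
     (\<forall>i. let u = p (Suc i) - p i; v = p (Suc (Suc i)) - p (Suc i); N = normalQ a b c (p (Suc i)) in
          (1 / norm v) *\<^sub>R v = (1 / norm u) *\<^sub>R u - (2 * (((1 / norm u) *\<^sub>R u) \<bullet> N) / (N \<bullet> N)) *\<^sub>R N)"

definition periodic_traj :: "real \<Rightarrow> real \<Rightarrow> real \<Rightarrow> (nat \<Rightarrow> real^3) \<Rightarrow> nat \<Rightarrow> bool" where
  "periodic_traj a b c p n \<longleftrightarrow> billiard_traj a b c p \<and> 0 < n \<and> (\<forall>i. p (i + n) = p i)"

text \<open>The line through q with direction d is tangent to Q_lambda (Joachimsthal: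
  the quadratic in t obtained by substituting q + t d has a double root, i.e. B^2 = A C).\<close>
definition line_tangent :: "real \<Rightarrow> real \<Rightarrow> real \<Rightarrow> real \<Rightarrow> real^3 \<Rightarrow> real^3 \<Rightarrow> bool" where
  "line_tangent a b c l q d \<longleftrightarrow>
     (let A = (d$1)^2/(a-l) + (d$2)^2/(b-l) + (d$3)^2/(c-l);
          B = (q$1)*(d$1)/(a-l) + (q$2)*(d$2)/(b-l) + (q$3)*(d$3)/(c-l);
          C = (q$1)^2/(a-l) + (q$2)^2/(b-l) + (q$3)^2/(c-l) - 1
      in B^2 = A * C)"

definition has_caustics :: "real \<Rightarrow> real \<Rightarrow> real \<Rightarrow> (nat \<Rightarrow> real^3) \<Rightarrow> real \<Rightarrow> real \<Rightarrow> bool" where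
  "has_caustics a b c p l1 l2 \<longleftrightarrow> l1 < l2 \<and>
     (\<forall>i. line_tangent a b c l1 (p i) (p (Suc i) - p i) \<and> line_tangent a b c l2 (p i) (p (Suc i) - p i))"

definition nonsingular :: "real \<Rightarrow> real \<Rightarrow> real \<Rightarrow> real \<Rightarrow> real \<Rightarrow> bool" where
  "nonsingular a b c l1 l2 \<longleftrightarrow> 0 < l1 \<and> l1 < l2 \<and> l1 \<notin> {a, b, c} \<and> l2 \<notin> {a, b, c}"

definition surf :: "real \<Rightarrow> real \<Rightarrow> real \<Rightarrow> real \<Rightarrow> (real^3) set" where
  "surf a b c mu =
     (if mu = 0 then confocal a b c 0
      else if mu = a then {x. x$1 = 0}
      else if mu = b then {x. x$2 = 0}
      else if mu = c then {x. x$3 = 0}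
      else confocal a b c mu)"

text \<open>Points of one period of the trajectory lying on S, counted along the trajectory:
  parameter pairs (i,t), segment i from p i to p (i+1), t in [0,1).\<close>
definition hits :: "(nat \<Rightarrow> real^3) \<Rightarrow> nat \<Rightarrow> (real^3) set \<Rightarrow> (nat \<times> real) set" where
  "hits p n S = {(i, t). i < n \<and> 0 \<le> t \<and> t < 1 \<and> p i + t *\<^sub>R (p (Suc i) - p i) \<in> S}"

definition cval :: "real \<Rightarrow> real \<Rightarrow> real \<Rightarrow> real \<Rightarrow> real \<Rightarrow> nat \<Rightarrow> real" where
  "cval a b c l1 l2 k = (if k = 0 then 0 else sorted_list_of_set {a, b, c, l1, l2} ! (k - 1))"

definition winding_numbers ::
  "real \<Rightarrow> real \<Rightarrow> real \<Rightarrow> (nat \<Rightarrow> real^3) \<Rightarrow> nat \<Rightarrow> real \<Rightarrow> real \<Rightarrow> nat \<Rightarrow> nat \<Rightarrow> nat \<Rightarrow> bool" where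
  "winding_numbers a b c p n l1 l2 m0 m1 m2 \<longleftrightarrow>
     (\<forall>j < 3. \<forall>k \<in> {2*j, 2*j+1}.
        finite (hits p n (surf a b c (cval a b c l1 l2 k))) \<and>
        card (hits p n (surf a b c (cval a b c l1 l2 k))) = [m0, m1, m2] ! j)"

definition type_EH1 :: "real \<Rightarrow> real \<Rightarrow> real \<Rightarrow> real \<Rightarrow> real \<Rightarrow> bool" where
  "type_EH1 a b c l1 l2 \<longleftrightarrow> 0 < l1 \<and> l1 < c \<and> c < l2 \<and> l2 < b"
definition type_H1H1 :: "real \<Rightarrow> real \<Rightarrow> real \<Rightarrow> real \<Rightarrow> real \<Rightarrow> bool" where
  "type_H1H1 a b c l1 l2 \<longleftrightarrow> c < l1 \<and> l1 < l2 \<and> l2 < b"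
definition type_EH2 :: "real \<Rightarrow> real \<Rightarrow> real \<Rightarrow> real \<Rightarrow> real \<Rightarrow> bool" where
  "type_EH2 a b c l1 l2 \<longleftrightarrow> 0 < l1 \<and> l1 < c \<and> b < l2 \<and> l2 < a"
definition type_H1H2 :: "real \<Rightarrow> real \<Rightarrow> real \<Rightarrow> real \<Rightarrow> real \<Rightarrow> bool" where
  "type_H1H2 a b c l1 l2 \<longleftrightarrow> c < l1 \<and> l1 < b \<and> b < l2 \<and> l2 < a"

end

theory Submission
  imports Defs
begin

text \<open>
  Multiplying the equation of the confocal quadric \<mu> by (a - \<mu>)(b - \<mu>)(c - \<mu>) gives a cubic in \<mu>
  whose roots at a point are its elliptic coordinates. Restricted to a line of the trajectory, it is
  a quadratic form in a homogeneous parameter, whose discriminant vanishes exactly at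
  c_1 < \<dots> < c_5; there the form is plus or minus the square of an affine function. As a cubic with
  negative leading coefficient cannot take signs -, +, -, + in this order, the zeros of the squares
  for the two ends of a coordinate range alternate, and the orthogonality of confocal quadrics
  carries the direction of motion through reflections. Counting one segment at a time, the numbers
  of hits of both ends differ by a telescoping term. Hence the winding numbers exist, with m_0 = n.

  A closed trajectory crosses a coordinate plane an even number of times, and it crosses x = 0
  at least once. So m_2 \<ge> 2, and the bounds follow from m_2 < m_1 < m_0 and the parity of those
  m_j that count crossings of a coordinate plane.
\<close>

section \<open>Sign patterns of cubics, quadratic forms and affine functions\<close>

text \<open>The third divided difference of a cubic is its leading coefficient, and values of signs
  -, +, -, + make it nonnegative. If it is 0, then \<open>f\<close> vanishes at \<open>w\<close>,
  \<open>x\<close>, \<open>y\<close>, and the second divided difference forces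
  \<open>B = 0\<close>.\<close>

lemma cubic_not_alternating:
  fixes f :: "real \<Rightarrow> real"
  assumes f: "\<And>x. f x = A * x^3 + B * x^2 + C * x + E"
    and lead: "A < 0 \<or> (A = 0 \<and> B < 0)"
    and ord: "w < x" "x < y" "y < z"
    and sgn: "f w \<le> 0" "f x \<ge> 0" "f y \<le> 0" "f z \<ge> 0"
  shows False
proof -
  define Vw Vx Vy Vz where "Vw = (y-x)*(z-x)*(z-y)" and "Vx = (y-w)*(z-w)*(z-y)"
    and "Vy = (x-w)*(z-w)*(z-x)" and "Vz = (x-w)*(y-w)*(y-x)"
  have pos: "Vw > 0" "Vx > 0" "Vy > 0" "Vz > 0"
    using ord by (auto simp: Vw_def Vx_def Vy_def Vz_def)
  \<comment> \<open>The third divided difference, cleared of denominators.\<close>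
  have id3: "- f w * Vw + f x * Vx - f y * Vy + f z * Vz = A * (Vw * ((x-w)*(y-w)*(z-w)))"
    unfolding f Vw_def Vx_def Vy_def Vz_def by algebra
  have "f w * Vw \<le> 0" "f x * Vx \<ge> 0" "f y * Vy \<le> 0" "f z * Vz \<ge> 0"
    using sgn pos by (auto simp: mult_le_0_iff)
  moreover have "A * (Vw * ((x-w)*(y-w)*(z-w))) \<le> 0"
    using lead pos ord by (intro mult_nonpos_nonneg) auto
  ultimately have z: "f w * Vw = 0" "f x * Vx = 0" "f y * Vy = 0"
    and "A * (Vw * ((x-w)*(y-w)*(z-w))) = 0"
    using id3 by linarith+
  then have "A = 0" using pos ord by auto
  have "f w = 0" "f x = 0" "f y = 0" using z pos by auto
  moreover have "f w * (y-x) - f x * (y-w) + f y * (x-w)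
      = B * ((x-w)*(y-w)*(y-x)) + A * (w+x+y) * ((x-w)*(y-w)*(y-x))"
    unfolding f by algebra
  ultimately have "B = 0" using \<open>A = 0\<close> ord by auto
  then show False using lead \<open>A = 0\<close> by simp
qed

lemma quadratic_form_eq_square:
  fixes A B C :: real
  assumes "B^2 = A * C" and "A \<ge> 0" and "C \<ge> 0"
  obtains r s where "\<And>t h. A * t^2 + 2 * B * t * h + C * h^2 = (r * t + s * h)^2"
proof -
  define r where "r = sqrt A"
  \<comment> \<open>\<open>s\<close> takes the sign of \<open>B\<close>, so that
    \<open>r * s = B\<close>.\<close>
  define s where "s = (if B \<ge> 0 then sqrt C else - sqrt C)"
  have "\<bar>B\<bar> = sqrt A * sqrt C"
    using assms by (metis real_sqrt_abs real_sqrt_mult)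
  then have "r^2 = A" "s^2 = C" "r * s = B"
    using assms by (auto simp: r_def s_def)
  then have "A * t^2 + 2 * B * t * h + C * h^2 = (r * t + s * h)^2" for t h
    by (simp add: power2_sum power_mult_distrib algebra_simps flip: \<open>r * s = B\<close>)
  then show thesis by (rule that)
qed

text \<open>Inside the gap the form is definite, so \<open>A\<close> has no zero and hence one sign
  there. By continuity the forms at both ends are semidefinite of that sign, and the strict value at
  \<open>e\<close> tells which sign it is.\<close>

lemma definite_gap_sign:
  fixes A B C :: "real \<Rightarrow> real"
  assumes cont: "continuous_on UNIV A" "continuous_on UNIV B" "continuous_on UNIV C"
    and "e \<noteq> l"
    and gap: "\<And>\<mu>. min e l < \<mu> \<Longrightarrow> \<mu> < max e l \<Longrightarrow> (B \<mu>)^2 < A \<mu> * C \<mu>"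
    and neg: "A e * t0^2 + 2 * B e * t0 * h0 + C e * h0^2 < 0"
  shows "A l * t^2 + 2 * B l * t * h + C l * h^2 \<le> 0"
proof -
  define I where "I = {min e l <..< max e l}"
  define Q where "Q t h \<mu> = A \<mu> * t^2 + 2 * B \<mu> * t * h + C \<mu> * h^2" for t h \<mu>
  have clI: "closure I = {min e l .. max e l}"
    unfolding I_def using \<open>e \<noteq> l\<close> by (intro closure_greaterThanLessThan) auto
  have contQ: "continuous_on S (Q t h)" for S t h
    unfolding Q_def
    by (intro continuous_intros continuous_on_subset[OF cont(1)] continuous_on_subset[OF cont(2)]
        continuous_on_subset[OF cont(3)]) auto
  have AQ: "A \<mu> * Q t h \<mu> \<ge> 0" if "\<mu> \<in> I" for \<mu> t h
  proof -
    have "A \<mu> * Q t h \<mu> = (A \<mu> * t + B \<mu> * h)^2 + (A \<mu> * C \<mu> - (B \<mu>)^2) * h^2"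
      unfolding Q_def by algebra
    moreover have "(B \<mu>)^2 < A \<mu> * C \<mu>" using gap that by (auto simp: I_def)
    ultimately show ?thesis by simp
  qed
  have A0: "A \<mu> \<noteq> 0" if "\<mu> \<in> I" for \<mu>
    using gap[of \<mu>] that by (auto simp: I_def)
  have "(\<forall>\<mu>\<in>I. A \<mu> > 0) \<or> (\<forall>\<mu>\<in>I. A \<mu> < 0)"
  proof (rule ccontr)
    assume "\<not> ?thesis"
    then obtain u v where uv: "u \<in> I" "v \<in> I" "A u < 0" "A v > 0"
      using A0 by (metis linorder_neqE_linordered_idom)
    have "connected (A ` I)"
      unfolding I_def
      by (intro connected_continuous_image continuous_on_subset[OF cont(1)]) auto
    then have "0 \<in> A ` I"
      using uv by (auto simp: connected_iff_interval intro: less_imp_le)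
    then show False using A0 by auto
  qed
  then show ?thesis
  proof
    assume pos: "\<forall>\<mu>\<in>I. A \<mu> > 0"
    then have "Q t0 h0 \<mu> \<ge> 0" if "\<mu> \<in> I" for \<mu>
      using AQ[OF that, of t0 h0] that by (auto simp: zero_le_mult_iff)
    then have "Q t0 h0 e \<ge> 0"
      using continuous_ge_on_closure[of I "Q t0 h0" e 0] contQ clI by auto
    then show ?thesis using neg by (simp add: Q_def)
  next
    assume "\<forall>\<mu>\<in>I. A \<mu> < 0"
    then have "Q t h \<mu> \<le> 0" if "\<mu> \<in> I" for \<mu>
      using AQ[OF that, of t h] that by (auto simp: zero_le_mult_iff)
    then have "Q t h l \<le> 0"
      using continuous_le_on_closure[of I "Q t h" l 0] contQ clI by auto
    then show ?thesis by (simp add: Q_def)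
  qed
qed

text \<open>A zero at the start of the segment counts and one at its end does not, so zeros at
  vertices are counted once along a trajectory.\<close>

lemma affine_zeros_unit_interval:
  fixes r s :: real
  assumes "r \<noteq> 0 \<or> s \<noteq> 0"
  shows "finite {t. 0 \<le> t \<and> t < 1 \<and> r * t + s = 0}"
    and "card {t. 0 \<le> t \<and> t < 1 \<and> r * t + s = 0} = of_bool (s = 0 \<or> s * (r + s) < 0)"
proof -
  have "{t. 0 \<le> t \<and> t < 1 \<and> r * t + s = 0} = (if s = 0 \<or> s * (r + s) < 0 then {- s / r} else {})"
  proof (cases "r = 0")
    case True
    then show ?thesis using assms by (auto simp: mult_less_0_iff)
  next
    case False
    then have "r * t + s = 0 \<longleftrightarrow> t = - s / r" for t by (auto simp: field_simps add_eq_0_iff)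
    moreover have "0 \<le> - s / r \<and> - s / r < 1 \<longleftrightarrow> s = 0 \<or> s * (r + s) < 0"
      using False
      by (cases "r > 0")
        (auto simp: divide_le_0_iff zero_le_divide_iff pos_divide_less_eq neg_divide_less_eq
          minus_divide_left mult_less_0_iff simp del: minus_divide_left[symmetric])
    ultimately show ?thesis by auto
  qed
  then show "finite {t. 0 \<le> t \<and> t < 1 \<and> r * t + s = 0}"
    and "card {t. 0 \<le> t \<and> t < 1 \<and> r * t + s = 0} = of_bool (s = 0 \<or> s * (r + s) < 0)"
    by auto
qed

text \<open>The segment from (s, s') to (x, y) turns around the origin in the direction given by the sign
  of W, so it crosses the two axes alternately.\<close>

lemma axis_crossings_alternate:
  fixes s s' x y :: real
  assumes W: "W = s * y - x * s'" "W \<noteq> 0"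
  shows "of_bool (s = 0 \<or> s * x < 0) - of_bool (s' = 0 \<or> s' * y < 0)
       = (of_bool (s = 0 \<or> W * s * s' > 0) - of_bool (x = 0 \<or> W * x * y > 0) :: int)"
proof -
  have sgW: "W > 0" if "s * y \<ge> 0" "x * s' \<le> 0" using W that by linarith
  have sgW': "W < 0" if "s * y \<le> 0" "x * s' \<ge> 0" using W that by linarith
  show ?thesis
    using sgW sgW' W(2)
    by (cases s "0::real" rule: linorder_cases; cases s' "0::real" rule: linorder_cases;
        cases x "0::real" rule: linorder_cases; cases y "0::real" rule: linorder_cases; cases "W > 0")
      (auto simp: zero_less_mult_iff mult_less_0_iff mult_le_0_iff zero_le_mult_iff)
qed


section \<open>The cubic of the confocal family\<close>

locale confocal_family =
  fixes a b c :: real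
  assumes c_pos: "0 < c" and c_less_b: "c < b" and b_less_a: "b < a"
begin

definition mixed :: "real^3 \<Rightarrow> real^3 \<Rightarrow> real \<Rightarrow> real" where
  "mixed x y \<mu> = x$1 * y$1 * ((b-\<mu>) * (c-\<mu>)) + x$2 * y$2 * ((a-\<mu>) * (c-\<mu>))
     + x$3 * y$3 * ((a-\<mu>) * (b-\<mu>))"

text \<open>\<open>h\<close> is a homogeneous coordinate: 1 for points, 0 for directions, where the
  degree in \<mu> drops to at most 2.\<close>

definition form :: "real \<Rightarrow> real^3 \<Rightarrow> real \<Rightarrow> real" where
  "form h x \<mu> = h^2 * ((a-\<mu>) * (b-\<mu>) * (c-\<mu>)) - mixed x x \<mu>"

text \<open>The leading coefficient is \<open>- (h^2)\<close>; for \<open>h = 0\<close> the next one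
  is minus the squared length of \<open>v\<close>.\<close>

lemma form_not_alternating:
  assumes "h \<noteq> 0 \<or> v \<noteq> 0" and "w < x" "x < y" "y < z"
    and "form h v w \<le> 0" "form h v x \<ge> 0" "form h v y \<le> 0" "form h v z \<ge> 0"
  shows False
proof (rule cubic_not_alternating[where f = "form h v" and w = w and x = x and y = y and z = z])
  show "form h v \<mu> = (- (h^2)) * \<mu>^3 + (h^2 * (a+b+c) - ((v$1)^2 + (v$2)^2 + (v$3)^2)) * \<mu>^2
      + (- (h^2) * (a * b + b * c + c * a) + (v$1)^2 * (b+c) + (v$2)^2 * (a+c) + (v$3)^2 * (a+b)) * \<mu>
      + (h^2 * (a * b * c) - (v$1)^2 * b * c - (v$2)^2 * a * c - (v$3)^2 * a * b)" for \<mu>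
    unfolding form_def mixed_def by algebra
  have "(v$1)^2 + (v$2)^2 + (v$3)^2 > 0" if "v \<noteq> 0"
    using that by (auto simp: vec_eq_iff forall_3 add_pos_nonneg add_nonneg_pos)
  then show "- (h^2) < 0 \<or> - (h^2) = 0 \<and> h^2 * (a+b+c) - ((v$1)^2 + (v$2)^2 + (v$3)^2) < 0"
    using assms(1) by (cases "h = 0") auto
qed (use assms in auto)

text \<open>Only one term survives at these parameters: the coordinate planes are the doubled
  members of the family.\<close>

lemma form_at_axes:
  "form h x a = - (a-b) * (a-c) * (x$1)^2"
  "form h x b = (a-b) * (b-c) * (x$2)^2"
  "form h x c = - (a-c) * (b-c) * (x$3)^2"
  by (simp_all add: form_def mixed_def power2_eq_square algebra_simps)

lemma form_at_axes_sign: "form h x a \<le> 0" "form h x b \<ge> 0" "form h x c \<le> 0"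
  using c_less_b b_less_a by (auto simp: form_at_axes mult_nonpos_nonneg mult_le_0_iff)

lemma form_at_axes_zero:
  "form h x a = 0 \<longleftrightarrow> x$1 = 0" "form h x b = 0 \<longleftrightarrow> x$2 = 0" "form h x c = 0 \<longleftrightarrow> x$3 = 0"
  using c_less_b b_less_a by (auto simp: form_at_axes)

lemma confocal_iff_form:
  assumes "\<mu> \<notin> {a, b, c}"
  shows "x \<in> confocal a b c \<mu> \<longleftrightarrow> form 1 x \<mu> = 0"
proof -
  have nz: "a - \<mu> \<noteq> 0" "b - \<mu> \<noteq> 0" "c - \<mu> \<noteq> 0" using assms by auto
  have "form 1 x \<mu> = ((a-\<mu>) * (b-\<mu>) * (c-\<mu>))
      * (1 - ((x$1)^2/(a-\<mu>) + (x$2)^2/(b-\<mu>) + (x$3)^2/(c-\<mu>)))"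
    using nz by (simp add: form_def mixed_def divide_simps power2_eq_square) (simp add: algebra_simps)
  then show ?thesis using nz by (auto simp: confocal_def)
qed

lemma surf_iff_form: "x \<in> surf a b c \<mu> \<longleftrightarrow> form 1 x \<mu> = 0"
proof (cases "\<mu> \<in> {a, b, c}")
  case True
  then show ?thesis
    using c_pos c_less_b b_less_a by (auto simp: surf_def form_at_axes_zero)
next
  case False
  then show ?thesis using confocal_iff_form[OF False, of x] by (auto simp: surf_def)
qed

lemma mixed_add_left: "mixed (x + y) z \<mu> = mixed x z \<mu> + mixed y z \<mu>"
  and mixed_scale_left: "mixed (k *\<^sub>R x) z \<mu> = k * mixed x z \<mu>"
  by (simp_all add: mixed_def algebra_simps)

lemma mixed_add_right: "mixed z (x + y) \<mu> = mixed z x \<mu> + mixed z y \<mu>"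
  and mixed_scale_right: "mixed z (k *\<^sub>R x) \<mu> = k * mixed z x \<mu>"
  by (simp_all add: mixed_def algebra_simps)

lemma continuous_on_form: "continuous_on S (form h x)"
  unfolding form_def mixed_def by (intro continuous_intros)

text \<open>The sign of the derivative at q, along the direction d, of the elliptic coordinate with range
  [lo, hi]; at the ends of the range it refers to the motion just before reaching q.\<close>

definition descending :: "real \<Rightarrow> real \<Rightarrow> real \<Rightarrow> real^3 \<Rightarrow> real^3 \<Rightarrow> bool" where
  "descending lo hi \<epsilon> q d \<longleftrightarrow>
     form 1 q lo = 0 \<or> (\<exists>m. lo < m \<and> m < hi \<and> form 1 q m = 0 \<and> \<epsilon> * mixed q d m < 0)"

text \<open>Joachimsthal's discriminant: up to the factor (a - \<mu>)(b - \<mu>)(c - \<mu>) it is a quadratic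
  polynomial in \<mu>, whose roots are the caustic parameters of the line.\<close>

definition caustic_poly :: "real^3 \<Rightarrow> real^3 \<Rightarrow> real \<Rightarrow> real" where
  "caustic_poly q d \<mu> = mixed d d \<mu> - (q$1 * d$2 - q$2 * d$1)^2 * (c-\<mu>)
     - (q$1 * d$3 - q$3 * d$1)^2 * (b-\<mu>) - (q$2 * d$3 - q$3 * d$2)^2 * (a-\<mu>)"

text \<open>Lagrange's identity with weights: the squares in \<open>caustic_poly\<close> are those
  of the components of the cross product of \<open>q\<close> and \<open>d\<close>.\<close>

lemma discriminant_caustic_poly:
  "(mixed q d \<mu>)^2 + mixed d d \<mu> * form 1 q \<mu> = (a-\<mu>) * (b-\<mu>) * (c-\<mu>) * caustic_poly q d \<mu>"
  unfolding mixed_def form_def caustic_poly_def power_one mult_1 by algebra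

lemma line_tangent_caustic_poly:
  assumes "\<mu> \<notin> {a, b, c}" and "line_tangent a b c \<mu> q d"
  shows "caustic_poly q d \<mu> = 0"
proof -
  define P where "P = (a-\<mu>) * (b-\<mu>) * (c-\<mu>)"
  define A where "A = (d$1)^2/(a-\<mu>) + (d$2)^2/(b-\<mu>) + (d$3)^2/(c-\<mu>)"
  define B where "B = (q$1)*(d$1)/(a-\<mu>) + (q$2)*(d$2)/(b-\<mu>) + (q$3)*(d$3)/(c-\<mu>)"
  define C where "C = (q$1)^2/(a-\<mu>) + (q$2)^2/(b-\<mu>) + (q$3)^2/(c-\<mu>) - 1"
  have nz: "a - \<mu> \<noteq> 0" "b - \<mu> \<noteq> 0" "c - \<mu> \<noteq> 0" using assms by auto
  then have "P \<noteq> 0" by (simp add: P_def)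
  have "mixed d d \<mu> = P * A" "mixed q d \<mu> = P * B" "form 1 q \<mu> = - P * C"
    using nz unfolding mixed_def form_def A_def B_def C_def P_def
    by (simp_all add: divide_simps power2_eq_square) (simp_all add: algebra_simps)
  moreover have "B^2 = A * C"
    using assms(2) by (simp add: line_tangent_def A_def B_def C_def Let_def)
  ultimately have "(mixed q d \<mu>)^2 + mixed d d \<mu> * form 1 q \<mu> = 0"
    by (simp add: power_mult_distrib power2_eq_square)
  then show ?thesis
    using discriminant_caustic_poly[of q d \<mu>] \<open>P \<noteq> 0\<close> by (simp add: P_def)
qed

end

section \<open>The ordered parameters of the four caustic types\<close>

locale caustic_pair = confocal_family +
  fixes l1 l2 :: real
  assumes l1_pos: "0 < l1" and l1_less_l2: "l1 < l2" and l1_less_b: "l1 < b" and c_less_l2: "c < l2"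
    and l2_less_a: "l2 < a" and l1_neq_c: "l1 \<noteq> c" and l2_neq_b: "l2 \<noteq> b"
begin

text \<open>In all four types \<open>l1\<close> lies on either side of \<open>c\<close>, and
  \<open>l2\<close> on either side of \<open>b\<close>, so sorting only permutes within these two
  pairs.\<close>

definition "c1 = min c l1"
definition "c2 = max c l1"
definition "c3 = min b l2"
definition "c4 = max b l2"

lemma c_order: "0 < c1" "c1 < c2" "c2 < c3" "c3 < c4" "c4 < a"
  using c_pos c_less_b b_less_a l1_pos l1_less_l2 l1_less_b c_less_l2 l2_less_a l1_neq_c l2_neq_b
  by (auto simp: c1_def c2_def c3_def c4_def)

text \<open>The ranges of the two elliptic coordinates that are not 0 on the ellipsoid; \<epsilon> is the sign of
  the cubic between the coordinate and the upper end of its range.\<close>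

definition coordinate_range :: "real \<Rightarrow> real \<Rightarrow> real \<Rightarrow> bool" where
  "coordinate_range lo hi \<epsilon> \<longleftrightarrow> (lo, hi, \<epsilon>) \<in> {(c2, c3, 1), (c4, a, -1)}"

lemma sorted_parameters: "sorted_list_of_set {a, b, c, l1, l2} = [c1, c2, c3, c4, a]"
proof -
  have "{a, b, c, l1, l2} = set [c1, c2, c3, c4, a]"
    by (auto simp: c1_def c2_def c3_def c4_def min_def max_def)
  moreover have "sorted_wrt (<) [c1, c2, c3, c4, a]" using c_order by auto
  ultimately show ?thesis
    by (metis sorted_list_of_set.idem_if_sorted_distinct strict_sorted_iff)
qed

lemma cval_values:
  "cval a b c l1 l2 0 = 0" "cval a b c l1 l2 1 = c1" "cval a b c l1 l2 2 = c2"
  "cval a b c l1 l2 3 = c3" "cval a b c l1 l2 4 = c4" "cval a b c l1 l2 5 = a"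
  by (simp_all add: cval_def sorted_parameters)

end

section \<open>Signs along a line tangent to both caustics\<close>

locale tangent_line = caustic_pair +
  fixes q d :: "real^3"
  assumes d_nonzero: "d \<noteq> 0"
    and tangent1: "line_tangent a b c l1 q d" and tangent2: "line_tangent a b c l2 q d"
begin

text \<open>Here h = 0 gives the point at infinity of the line, which may be its point of tangency with a
  hyperboloid.\<close>

definition K :: "real \<Rightarrow> real \<Rightarrow> real \<Rightarrow> real" where
  "K t h \<mu> = form h (h *\<^sub>R q + t *\<^sub>R d) \<mu>"

lemma K_expand:
  "K t h \<mu> = - mixed d d \<mu> * t^2 + 2 * (- mixed q d \<mu>) * t * h + form 1 q \<mu> * h^2"
  unfolding K_def form_def mixed_def by (simp add: algebra_simps power2_eq_square)

lemma K_not_alternating: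
  assumes "t \<noteq> 0 \<or> h \<noteq> 0" and "w < x" "x < y" "y < z"
    and "K t h w \<le> 0" "K t h x \<ge> 0" "K t h y \<le> 0" "K t h z \<ge> 0"
  shows False
  by (rule form_not_alternating[of h "h *\<^sub>R q + t *\<^sub>R d" w x y z])
    (use assms d_nonzero in \<open>auto simp: K_def\<close>)

text \<open>A quadratic with leading coefficient \<open>d \<bullet> d\<close>, whose two distinct
  roots are given by the tangencies.\<close>

lemma caustic_poly_factor: "caustic_poly q d \<mu> = (d \<bullet> d) * (\<mu> - l1) * (\<mu> - l2)"
proof -
  have "l1 \<notin> {a, b, c}" "l2 \<notin> {a, b, c}"
    using l1_less_b b_less_a c_less_l2 l2_less_a l1_neq_c l2_neq_b by auto
  then have roots: "caustic_poly q d l1 = 0" "caustic_poly q d l2 = 0"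
    using line_tangent_caustic_poly tangent1 tangent2 by auto
  define M where "M = d \<bullet> d"
  have M: "M = (d$1)^2 + (d$2)^2 + (d$3)^2"
    by (simp add: M_def inner_vec_def sum_3 power2_eq_square)
  obtain e f where ef: "\<And>\<mu>. caustic_poly q d \<mu> = M * \<mu>^2 + e * \<mu> + f"
  proof
    show "caustic_poly q d \<mu> = M * \<mu>^2 + (- ((d$1)^2) * (b+c) - (d$2)^2 * (a+c) - (d$3)^2 * (a+b)
        + (q$1 * d$2 - q$2 * d$1)^2 + (q$1 * d$3 - q$3 * d$1)^2 + (q$2 * d$3 - q$3 * d$2)^2) * \<mu>
        + ((d$1)^2 * b * c + (d$2)^2 * a * c + (d$3)^2 * a * b - (q$1 * d$2 - q$2 * d$1)^2 * c
          - (q$1 * d$3 - q$3 * d$1)^2 * b - (q$2 * d$3 - q$3 * d$2)^2 * a)" for \<mu>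
      unfolding caustic_poly_def mixed_def M by algebra
  qed
  have "(l1 - l2) * (M * (l1 + l2) + e) = 0"
    using roots unfolding ef by algebra
  then have e: "e = - M * (l1 + l2)" using l1_less_l2 by auto
  then have "f = M * l1 * l2" using roots(1) unfolding ef by algebra
  then show ?thesis unfolding ef e M_def[symmetric] by algebra
qed

lemma discriminant:
  "(mixed q d \<mu>)^2 + mixed d d \<mu> * form 1 q \<mu>
    = (d \<bullet> d) * ((a-\<mu>) * (b-\<mu>) * (c-\<mu>) * (\<mu> - l1) * (\<mu> - l2))"
  unfolding discriminant_caustic_poly caustic_poly_factor by algebra

text \<open>For a line inside a coordinate plane, \<open>caustic_poly\<close> would vanish at
  \<open>a\<close>, \<open>b\<close> or \<open>c\<close>, but its only roots are \<open>l1\<close>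
  and \<open>l2\<close>.\<close>

lemma coordinate_nonzero: "q$1 \<noteq> 0 \<or> d$1 \<noteq> 0" "q$2 \<noteq> 0 \<or> d$2 \<noteq> 0" "q$3 \<noteq> 0 \<or> d$3 \<noteq> 0"
proof -
  have *: "caustic_poly q d a \<noteq> 0" "caustic_poly q d b \<noteq> 0" "caustic_poly q d c \<noteq> 0"
    using d_nonzero l1_less_b b_less_a c_less_l2 l2_less_a l1_neq_c l2_neq_b l1_less_l2
    by (auto simp: caustic_poly_factor)
  show "q$1 \<noteq> 0 \<or> d$1 \<noteq> 0" "q$2 \<noteq> 0 \<or> d$2 \<noteq> 0" "q$3 \<noteq> 0 \<or> d$3 \<noteq> 0"
    using * by (auto simp: caustic_poly_def mixed_def)
qed

text \<open>The line is not inside the plane z = 0; this yields the strict value from which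
  \<open>definite_gap_sign\<close> starts.\<close>

lemma K_c_strict:
  obtains t0 h0 where "K t0 h0 c < 0"
proof -
  have "K 0 1 c < 0 \<or> K 1 0 c < 0"
    using coordinate_nonzero(3) form_at_axes_sign(3)[of 1 q] form_at_axes_sign(3)[of 0 d]
    by (auto simp: K_def form_at_axes_zero less_le)
  then show thesis using that by blast
qed

lemma K_b_strict:
  obtains t0 h0 where "K t0 h0 b > 0"
proof -
  have "K 0 1 b > 0 \<or> K 1 0 b > 0"
    using coordinate_nonzero(2) form_at_axes_sign(2)[of 1 q] form_at_axes_sign(2)[of 0 d]
      form_at_axes_zero(2)[of 1 q] form_at_axes_zero(2)[of 0 d]
    by (auto simp: K_def less_le)
  then show thesis using that by blast
qed

text \<open>Between \<open>c\<close> and \<open>l1\<close> the discriminant is negative, so the sign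
  known at \<open>c\<close> passes to \<open>l1\<close>.\<close>

lemma K_l1: "K t h l1 \<le> 0"
proof -
  obtain t0 h0 where neg: "K t0 h0 c < 0" by (rule K_c_strict)
  show ?thesis
    unfolding K_expand
  proof (rule definite_gap_sign[where A = "\<lambda>\<mu>. - mixed d d \<mu>" and B = "\<lambda>\<mu>. - mixed q d \<mu>"
        and C = "form 1 q" and e = c and ?t0.0 = t0 and ?h0.0 = h0])
    show "continuous_on UNIV (\<lambda>\<mu>. - mixed d d \<mu>)" "continuous_on UNIV (\<lambda>\<mu>. - mixed q d \<mu>)"
      unfolding mixed_def by (intro continuous_intros)+
    show "continuous_on UNIV (form 1 q)" by (rule continuous_on_form)
    show "(- mixed q d \<mu>)^2 < - mixed d d \<mu> * form 1 q \<mu>"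
      if "min c l1 < \<mu>" "\<mu> < max c l1" for \<mu>
    proof -
      have "(c-\<mu>) * (\<mu>-l1) > 0" using that by (auto simp: zero_less_mult_iff min_def max_def split: if_splits)
      moreover have "a - \<mu> > 0" "b - \<mu> > 0" "l2 - \<mu> > 0" "d \<bullet> d > 0"
        using that c_less_b b_less_a l1_less_b l1_less_l2 c_less_l2 d_nonzero by auto
      ultimately have "(d \<bullet> d) * ((a-\<mu>) * ((b-\<mu>) * ((l2-\<mu>) * ((c-\<mu>) * (\<mu>-l1))))) > 0" by simp
      moreover have "(mixed q d \<mu>)^2 + mixed d d \<mu> * form 1 q \<mu>
          = - ((d \<bullet> d) * ((a-\<mu>) * ((b-\<mu>) * ((l2-\<mu>) * ((c-\<mu>) * (\<mu>-l1))))))"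
        unfolding discriminant by algebra
      ultimately show ?thesis by simp
    qed
  qed (use neg l1_neq_c in \<open>auto simp: K_expand\<close>)
qed

lemma K_l2: "K t h l2 \<ge> 0"
proof -
  obtain t0 h0 where pos: "K t0 h0 b > 0" by (rule K_b_strict)
  \<comment> \<open>The argument of \<open>K_l1\<close>, now for \<open>- K\<close> and starting
    from \<open>b\<close>.\<close>
  have "mixed d d l2 * t^2 + 2 * mixed q d l2 * t * h + - form 1 q l2 * h^2 \<le> 0"
  proof (rule definite_gap_sign[where A = "mixed d d" and B = "mixed q d"
        and C = "\<lambda>\<mu>. - form 1 q \<mu>" and e = b and ?t0.0 = t0 and ?h0.0 = h0])
    show "continuous_on UNIV (mixed d d)" "continuous_on UNIV (mixed q d)"
      unfolding mixed_def by (intro continuous_intros)+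
    show "continuous_on UNIV (\<lambda>\<mu>. - form 1 q \<mu>)"
      by (intro continuous_on_minus continuous_on_form)
    show "(mixed q d \<mu>)^2 < mixed d d \<mu> * - form 1 q \<mu>"
      if "min b l2 < \<mu>" "\<mu> < max b l2" for \<mu>
    proof -
      have "(b-\<mu>) * (\<mu>-l2) > 0" using that by (auto simp: zero_less_mult_iff min_def max_def split: if_splits)
      moreover have "a - \<mu> > 0" "\<mu> - c > 0" "\<mu> - l1 > 0" "d \<bullet> d > 0"
        using that c_less_b b_less_a l1_less_b l1_less_l2 c_less_l2 l2_less_a d_nonzero by auto
      ultimately have "(d \<bullet> d) * ((a-\<mu>) * ((\<mu>-c) * ((\<mu>-l1) * ((b-\<mu>) * (\<mu>-l2))))) > 0" by simp
      moreover have "(mixed q d \<mu>)^2 + mixed d d \<mu> * form 1 q \<mu>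
          = - ((d \<bullet> d) * ((a-\<mu>) * ((\<mu>-c) * ((\<mu>-l1) * ((b-\<mu>) * (\<mu>-l2))))))"
        unfolding discriminant by algebra
      ultimately show ?thesis by simp
    qed
  qed (use pos l2_neq_b in \<open>auto simp: K_expand\<close>)
  then show ?thesis by (simp add: K_expand)
qed

lemma K_sign: "K t h c1 \<le> 0" "K t h c2 \<le> 0" "K t h c3 \<ge> 0" "K t h c4 \<ge> 0" "K t h a \<le> 0"
  using K_l1[of t h] K_l2[of t h] form_at_axes_sign[of h "h *\<^sub>R q + t *\<^sub>R d"]
  by (auto simp: c1_def c2_def c3_def c4_def min_def max_def K_def)

lemma discriminant_zero:
  assumes "\<mu> \<in> {c1, c2, c3, c4, a}"
  shows "(mixed q d \<mu>)^2 = - mixed d d \<mu> * form 1 q \<mu>"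
proof -
  have "\<mu> \<in> {a, b, c, l1, l2}" using assms
    by (auto simp: c1_def c2_def c3_def c4_def min_def max_def split: if_splits)
  then have "(a-\<mu>) * (b-\<mu>) * (c-\<mu>) * (\<mu> - l1) * (\<mu> - l2) = 0" by auto
  then show ?thesis using discriminant[of \<mu>] by auto
qed

lemma K_signed_square:
  assumes "\<mu> \<in> {c1, c2, c3, c4, a}" and "\<sigma> = 1 \<or> \<sigma> = -1" and "\<And>t h. \<sigma> * K t h \<mu> \<ge> 0"
  obtains r s where "\<And>t h. \<sigma> * K t h \<mu> = (r * t + s * h)^2"
proof -
  have "(- \<sigma> * mixed q d \<mu>)^2 = (- \<sigma> * mixed d d \<mu>) * (\<sigma> * form 1 q \<mu>)"
    using discriminant_zero[OF assms(1)] assms(2) by auto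
  moreover have "- \<sigma> * mixed d d \<mu> \<ge> 0" "\<sigma> * form 1 q \<mu> \<ge> 0"
    using assms(3)[of 1 0] assms(3)[of 0 1] by (auto simp: K_expand)
  ultimately obtain r s where
    "\<And>t h. (- \<sigma> * mixed d d \<mu>) * t^2 + 2 * (- \<sigma> * mixed q d \<mu>) * t * h + \<sigma> * form 1 q \<mu> * h^2 = (r * t + s * h)^2"
    by (rule quadratic_form_eq_square) blast
  then show thesis using that[of r s] by (simp add: K_expand algebra_simps)
qed

text \<open>A zero may count as either sign, so a failing inequality would give the signs -, +, -, +
  at four parameters.\<close>

lemma K_strict:
  assumes "t \<noteq> 0 \<or> h \<noteq> 0"
  shows "K t h c1 = 0 \<Longrightarrow> m < c1 \<Longrightarrow> K t h m > 0"
    and "K t h c2 = 0 \<Longrightarrow> c2 < m \<Longrightarrow> m < c3 \<Longrightarrow> K t h m > 0"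
    and "K t h c3 = 0 \<Longrightarrow> c2 < m \<Longrightarrow> m < c3 \<Longrightarrow> K t h m < 0"
    and "K t h c4 = 0 \<Longrightarrow> c4 < m \<Longrightarrow> m < a \<Longrightarrow> K t h m < 0"
    and "K t h a = 0 \<Longrightarrow> c4 < m \<Longrightarrow> m < a \<Longrightarrow> K t h m > 0"
proof -
  note na = K_not_alternating[OF assms]
  show "K t h c1 = 0 \<Longrightarrow> m < c1 \<Longrightarrow> K t h m > 0"
    using na[of m c1 c2 c3] c_order K_sign[of t h] by force
  show "K t h c2 = 0 \<Longrightarrow> c2 < m \<Longrightarrow> m < c3 \<Longrightarrow> K t h m > 0"
    using na[of c1 c2 m c4] c_order K_sign[of t h] by force
  show "K t h c3 = 0 \<Longrightarrow> c2 < m \<Longrightarrow> m < c3 \<Longrightarrow> K t h m < 0"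
    using na[of c2 m c3 c4] c_order K_sign[of t h] by force
  show "K t h c4 = 0 \<Longrightarrow> c4 < m \<Longrightarrow> m < a \<Longrightarrow> K t h m < 0"
    using na[of c1 c3 c4 m] c_order K_sign[of t h] by force
  show "K t h a = 0 \<Longrightarrow> c4 < m \<Longrightarrow> m < a \<Longrightarrow> K t h m > 0"
    using na[of c1 c3 m a] c_order K_sign[of t h] by force
qed


section \<open>Motion of an elliptic coordinate along a line\<close>

lemma K_shift: "form 1 (q + t *\<^sub>R d) \<mu> = K t 1 \<mu>"
  by (simp add: K_def)

text \<open>Taylor expansion at the point with parameter \<tau>; the middle coefficient holds the
  derivative along \<open>d\<close>.\<close>

lemma K_recenter:
  "K (t + \<tau> * h) h \<mu>
    = - mixed d d \<mu> * t^2 - 2 * mixed (q + \<tau> *\<^sub>R d) d \<mu> * t * h + K \<tau> 1 \<mu> * h^2"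
  unfolding K_expand mixed_add_left mixed_scale_left
  by (simp add: algebra_simps power2_eq_square)

text \<open>Multiplying by \<epsilon> gives both ranges the same signs, so that one argument serves
  for both.\<close>

lemma range_K:
  assumes "coordinate_range lo hi \<epsilon>"
  shows "lo < hi" "\<epsilon> = 1 \<or> \<epsilon> = -1" "lo \<in> {c1, c2, c3, c4, a}" "hi \<in> {c1, c2, c3, c4, a}"
    and "- \<epsilon> * K t h lo \<ge> 0" "\<epsilon> * K t h hi \<ge> 0"
    and "t \<noteq> 0 \<or> h \<noteq> 0 \<Longrightarrow> K t h lo = 0 \<Longrightarrow> lo < m \<Longrightarrow> m < hi \<Longrightarrow> \<epsilon> * K t h m > 0"
    and "t \<noteq> 0 \<or> h \<noteq> 0 \<Longrightarrow> K t h hi = 0 \<Longrightarrow> lo < m \<Longrightarrow> m < hi \<Longrightarrow> \<epsilon> * K t h m < 0"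
  using assms c_order K_sign[of t h] K_strict[of t h m] by (auto simp: coordinate_range_def)

context
  fixes lo hi \<epsilon> r s r' s' W :: real
  assumes range: "coordinate_range lo hi \<epsilon>"
    and sq_lo: "\<And>t h. - \<epsilon> * K t h lo = (r * t + s * h)^2"
    and sq_hi: "\<And>t h. \<epsilon> * K t h hi = (r' * t + s' * h)^2"
    and W_def: "W = s * r' - r * s'"
begin

lemma K_lo_zero_iff: "K t h lo = 0 \<longleftrightarrow> r * t + s * h = 0"
  using sq_lo[of t h] range_K(2)[OF range] by auto

lemma K_hi_zero_iff: "K t h hi = 0 \<longleftrightarrow> r' * t + s' * h = 0"
  using sq_hi[of t h] range_K(2)[OF range] by auto

text \<open>At a common zero of the two linear forms, \<open>K\<close> would vanish at both
  \<open>lo\<close> and \<open>hi\<close>, and so have both strict signs in between.\<close>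

lemma wronskian_nonzero: "W \<noteq> 0"
proof
  assume "W = 0"
  then have eq: "s * r' = r * s'" by (simp add: W_def)
  have "\<exists>t h. (t \<noteq> 0 \<or> h \<noteq> 0) \<and> r * t + s * h = 0 \<and> r' * t + s' * h = 0"
  proof (cases "r = 0 \<and> s = 0")
    case False
    then show ?thesis using eq by (intro exI[of _ "-s"] exI[of _ r]) (auto simp: algebra_simps)
  next
    case rs: True
    show ?thesis
    proof (cases "r' = 0 \<and> s' = 0")
      case False
      then show ?thesis using rs by (intro exI[of _ "-s'"] exI[of _ r']) auto
    next
      case True
      then show ?thesis using rs by auto
    qed
  qed
  then obtain t h where th: "t \<noteq> 0 \<or> h \<noteq> 0" "K t h lo = 0" "K t h hi = 0"
    using K_lo_zero_iff K_hi_zero_iff by blast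
  obtain m where "lo < m" "m < hi" using range_K(1)[OF range] dense by blast
  then show False
    using range_K(7)[OF range th(1,2)] range_K(8)[OF range th(1,3)] by fastforce
qed

text \<open>With x = \<open>r * \<tau> + s\<close> and y = \<open>r' * \<tau> + s'\<close>, the
  derivative of (x/y)^2 in \<tau> has the sign of -Wxy. So Wxy > 0 means that the contact x = 0 with
  \<open>lo\<close> gains on the contact y = 0 with \<open>hi\<close>, that is, the coordinate moves
  down.\<close>

lemma root_direction:
  assumes m: "lo < m" "m < hi" and root: "K \<tau> 1 m = 0"
  shows "\<epsilon> * mixed (q + \<tau> *\<^sub>R d) d m < 0 \<longleftrightarrow> W * (r * \<tau> + s) * (r' * \<tau> + s') > 0"
    and "r * \<tau> + s \<noteq> 0" and "r' * \<tau> + s' \<noteq> 0"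
proof -
  define x y \<alpha> \<beta> where "x = r * \<tau> + s" and "y = r' * \<tau> + s'"
    and "\<alpha> = - \<epsilon> * mixed d d m" and "\<beta> = - \<epsilon> * mixed (q + \<tau> *\<^sub>R d) d m"
  show x: "r * \<tau> + s \<noteq> 0"
    using range_K(7)[OF range _ _ m, of \<tau> 1] root K_lo_zero_iff[of \<tau> 1] by auto
  show y: "r' * \<tau> + s' \<noteq> 0"
    using range_K(8)[OF range _ _ m, of \<tau> 1] root K_hi_zero_iff[of \<tau> 1] by auto
  have K: "\<epsilon> * K (t + \<tau> * h) h m = \<alpha> * t^2 + 2 * \<beta> * t * h" for t h
    unfolding K_recenter root \<alpha>_def \<beta>_def by (simp add: algebra_simps)
  \<comment> \<open>The form at \<open>m\<close> is evaluated at the zeros of the two linear forms,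
    where its sign is known.\<close>
  have "K (- x + \<tau> * r) r lo = 0" "K (- y + \<tau> * r') r' hi = 0"
    by (auto simp: K_lo_zero_iff K_hi_zero_iff x_def y_def algebra_simps)
  moreover have "- x + \<tau> * r \<noteq> 0 \<or> r \<noteq> 0" "- y + \<tau> * r' \<noteq> 0 \<or> r' \<noteq> 0"
    using x y by (auto simp: x_def y_def)
  ultimately have "\<epsilon> * K (- x + \<tau> * r) r m > 0" "\<epsilon> * K (- y + \<tau> * r') r' m < 0"
    using range_K(7,8)[OF range] m by blast+
  then have "\<alpha> * (- x)^2 + 2 * \<beta> * (- x) * r > 0" "\<alpha> * (- y)^2 + 2 * \<beta> * (- y) * r' < 0"
    unfolding K .
  moreover have "y^2 > 0" "x^2 > 0" using x y by (auto simp: x_def y_def)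
  ultimately have "(\<alpha> * (- x)^2 + 2 * \<beta> * (- x) * r) * y^2 > 0"
      "(\<alpha> * (- y)^2 + 2 * \<beta> * (- y) * r') * x^2 < 0"
    by (auto simp only: mult_pos_pos mult_neg_pos)
  \<comment> \<open>The factors \<open>y^2\<close> and \<open>x^2\<close> make the terms with
    \<alpha> cancel.\<close>
  moreover have "(\<alpha> * (- x)^2 + 2 * \<beta> * (- x) * r) * y^2 - (\<alpha> * (- y)^2 + 2 * \<beta> * (- y) * r') * x^2
      = 2 * (\<beta> * (W * x * y))"
    unfolding W_def x_def y_def by algebra
  ultimately have "\<beta> * (W * x * y) > 0" by linarith
  then have "\<beta> > 0 \<longleftrightarrow> W * x * y > 0"
    using zero_less_mult_iff[of \<beta> "W * x * y"] by linarith
  then show "\<epsilon> * mixed (q + \<tau> *\<^sub>R d) d m < 0 \<longleftrightarrow> W * (r * \<tau> + s) * (r' * \<tau> + s') > 0"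
    by (simp add: \<beta>_def x_def y_def)
qed

text \<open>If neither linear form vanishes, the intermediate value theorem gives a root inside the
  range; if one vanishes, no such root exists.\<close>

lemma descending_iff:
  "descending lo hi \<epsilon> (q + \<tau> *\<^sub>R d) d
    \<longleftrightarrow> r * \<tau> + s = 0 \<or> W * (r * \<tau> + s) * (r' * \<tau> + s') > 0"
proof (cases "r * \<tau> + s = 0 \<or> r' * \<tau> + s' = 0")
  case True
  then show ?thesis
    using root_direction(2,3)[of _ \<tau>] K_lo_zero_iff[of \<tau> 1]
    by (auto simp: descending_def K_shift)
next
  case False
  have "- \<epsilon> * K \<tau> 1 lo > 0" "\<epsilon> * K \<tau> 1 hi > 0"
    using False sq_lo[of \<tau> 1] sq_hi[of \<tau> 1] by auto
  moreover have "continuous_on {lo..hi} (\<lambda>\<mu>. \<epsilon> * K \<tau> 1 \<mu>)"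
    unfolding K_def by (intro continuous_intros continuous_on_form)
  ultimately obtain m where "lo \<le> m" "m \<le> hi" "\<epsilon> * K \<tau> 1 m = 0"
    using IVT'[of "\<lambda>\<mu>. \<epsilon> * K \<tau> 1 \<mu>" lo 0 hi] range_K(1)[OF range] by force
  moreover have "m \<noteq> lo" "m \<noteq> hi"
    using \<open>- \<epsilon> * K \<tau> 1 lo > 0\<close> \<open>\<epsilon> * K \<tau> 1 hi > 0\<close> \<open>\<epsilon> * K \<tau> 1 m = 0\<close> by auto
  ultimately have "lo < m" "m < hi" "K \<tau> 1 m = 0"
    using range_K(2)[OF range] by auto
  then show ?thesis
    using False root_direction(1)[of _ \<tau>] K_lo_zero_iff[of \<tau> 1]
    by (auto simp: descending_def K_shift)
qed

end

text \<open>The zeros for \<open>lo\<close> and \<open>hi\<close> are crossings of the two axes by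
  the segment from \<open>(s, s')\<close> to \<open>(r + s, r' + s')\<close>. These alternate, so
  the difference of their numbers depends only on the ends.\<close>

lemma segment_zeros_telescope:
  assumes range: "coordinate_range lo hi \<epsilon>"
  defines "Z \<equiv> \<lambda>\<mu>. {t. 0 \<le> t \<and> t < 1 \<and> form 1 (q + t *\<^sub>R d) \<mu> = 0}"
  shows "finite (Z lo)" "finite (Z hi)"
    and "int (card (Z lo)) - int (card (Z hi))
      = of_bool (descending lo hi \<epsilon> q d) - of_bool (descending lo hi \<epsilon> (q + d) d)"
proof -
  note R = range_K[OF range]
  obtain r s where lo: "\<And>t h. - \<epsilon> * K t h lo = (r * t + s * h)^2"
    using K_signed_square[of lo "- \<epsilon>"] R(2,3,5) by fastforce
  obtain r' s' where hi: "\<And>t h. \<epsilon> * K t h hi = (r' * t + s' * h)^2"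
    using K_signed_square[of hi \<epsilon>] R(2,4,6) by fastforce
  define W where "W = s * r' - r * s'"
  note loc = range lo hi W_def
  have W: "W \<noteq> 0" by (rule wronskian_nonzero[OF loc])
  then have rs: "r \<noteq> 0 \<or> s \<noteq> 0" "r' \<noteq> 0 \<or> s' \<noteq> 0" by (auto simp: W_def)
  have Z: "Z lo = {t. 0 \<le> t \<and> t < 1 \<and> r * t + s = 0}" "Z hi = {t. 0 \<le> t \<and> t < 1 \<and> r' * t + s' = 0}"
    using K_lo_zero_iff[OF loc, of _ 1] K_hi_zero_iff[OF loc, of _ 1] by (auto simp: Z_def K_shift)
  show "finite (Z lo)" "finite (Z hi)"
    unfolding Z using affine_zeros_unit_interval(1) rs by auto
  have "int (card (Z lo)) - int (card (Z hi))
      = of_bool (s = 0 \<or> s * (r + s) < 0) - of_bool (s' = 0 \<or> s' * (r' + s') < 0)"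
    unfolding Z affine_zeros_unit_interval(2)[OF rs(1)] affine_zeros_unit_interval(2)[OF rs(2)]
    by simp
  also have "\<dots> = of_bool (s = 0 \<or> W * s * s' > 0)
      - of_bool (r + s = 0 \<or> W * (r + s) * (r' + s') > 0)"
    by (rule axis_crossings_alternate) (use W in \<open>auto simp: W_def algebra_simps\<close>)
  finally show "int (card (Z lo)) - int (card (Z hi))
      = of_bool (descending lo hi \<epsilon> q d) - of_bool (descending lo hi \<epsilon> (q + d) d)"
    using descending_iff[OF loc, of 0] descending_iff[OF loc, of 1] by simp
qed

text \<open>Where \<open>K\<close> vanishes at \<open>c1\<close> it is positive at 0, which holds
  only strictly inside the chord: each chord has one contact with the first surface.\<close>

lemma chord_zeros:
  assumes "form 1 q 0 = 0" and "form 1 (q + d) 0 = 0"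
  defines "Z \<equiv> \<lambda>\<mu>. {t. 0 \<le> t \<and> t < 1 \<and> form 1 (q + t *\<^sub>R d) \<mu> = 0}"
  shows "Z 0 = {0}" and "finite (Z c1)" and "card (Z c1) = 1"
proof -
  define \<alpha> where "\<alpha> = mixed d d 0"
  have "\<alpha> > 0"
    using d_nonzero c_pos c_less_b b_less_a
    by (auto simp: \<alpha>_def mixed_def vec_eq_iff forall_3 add_pos_nonneg add_nonneg_pos
        simp flip: power2_eq_square)
  have "K 1 1 0 = 0" using assms(2) K_shift[of 1 0] by simp
  then have "mixed q d 0 * 2 = - \<alpha>" using assms(1) by (simp add: K_expand \<alpha>_def)
  then have K: "K t h 0 = - \<alpha> * (t * (t - h))" for t h
    using assms(1) unfolding K_expand \<alpha>_def by algebra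
  show "Z 0 = {0}" using \<open>\<alpha> > 0\<close> by (auto simp: Z_def K_shift K)
  obtain r s where sq: "\<And>t h. -1 * K t h c1 = (r * t + s * h)^2"
    using K_signed_square[of c1 "-1"] K_sign(1) by fastforce
  have zero: "K t h c1 = 0 \<longleftrightarrow> r * t + s * h = 0" for t h using sq[of t h] by auto
  have pos: "t * (t - h) < 0" if "t \<noteq> 0 \<or> h \<noteq> 0" "r * t + s * h = 0" for t h
    using K_strict(1)[of t h 0] that c_order \<open>\<alpha> > 0\<close> zero[of t h]
    by (simp add: K mult_less_0_iff zero_less_mult_iff)
  have rs: "r \<noteq> 0 \<or> s \<noteq> 0" using pos[of 0 1] by auto
  \<comment> \<open>\<open>(-s, r)\<close> is the zero of the linear form in homogeneous
    coordinates.\<close>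
  then have "s * (r + s) < 0" using pos[of "-s" r] by (auto simp: algebra_simps)
  moreover have "Z c1 = {t. 0 \<le> t \<and> t < 1 \<and> r * t + s = 0}"
    using zero[of _ 1] by (auto simp: Z_def K_shift)
  ultimately show "finite (Z c1)" "card (Z c1) = 1"
    using affine_zeros_unit_interval[OF rs] by auto
qed

end


section \<open>Counting hits along a periodic trajectory\<close>

text \<open>\<sigma> reads the sign just before the point: a zero reached with \<open>d < 0\<close>
  still counts as positive. This matches the half-open interval.\<close>

lemma card_affine_zeros_parity:
  fixes x d :: real
  assumes "d \<noteq> 0 \<or> x \<noteq> 0"
  defines "\<sigma> \<equiv> \<lambda>z. z > 0 \<or> (z = 0 \<and> d < 0)"
  shows "even (int (card {t. 0 \<le> t \<and> t < 1 \<and> d * t + x = 0}) - (of_bool (\<sigma> x) - of_bool (\<sigma> (x + d))))"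
  unfolding affine_zeros_unit_interval(2)[OF assms(1)] \<sigma>_def
  using assms(1) by (auto simp: mult_less_0_iff)

locale caustic_trajectory = caustic_pair +
  fixes p :: "nat \<Rightarrow> real^3" and n :: nat
  assumes periodic: "periodic_traj a b c p n" and caustics: "has_caustics a b c p l1 l2"
begin

definition edge :: "nat \<Rightarrow> real^3" where
  "edge i = p (Suc i) - p i"

definition vel :: "nat \<Rightarrow> real^3" where
  "vel i = (1 / norm (edge i)) *\<^sub>R edge i"

definition N :: "nat \<Rightarrow> real^3" where
  "N i = normalQ a b c (p (Suc i))"

lemma p_Suc: "p (Suc i) = p i + edge i"
  by (simp add: edge_def)

lemma edge_nonzero: "edge i \<noteq> 0"
  using periodic by (simp add: periodic_traj_def billiard_traj_def edge_def)

lemma edge_vel: "edge i = norm (edge i) *\<^sub>R vel i"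
  using edge_nonzero[of i] by (simp add: vel_def)

lemma vel_Suc: "vel (Suc i) = vel i - (2 * (vel i \<bullet> N i) / (N i \<bullet> N i)) *\<^sub>R N i"
  using periodic
  unfolding periodic_traj_def billiard_traj_def vel_def edge_def N_def Let_def by blast

lemma p_on_ellipsoid: "form 1 (p i) 0 = 0"
  using periodic confocal_iff_form[of 0 "p i"] c_pos c_less_b b_less_a
  by (auto simp: periodic_traj_def billiard_traj_def)

lemma p_period: "p (i + n) = p i" and n_pos: "0 < n"
  using periodic by (auto simp: periodic_traj_def)

lemma edge_period: "edge (i + n) = edge i"
  using p_period[of i] p_period[of "Suc i"] by (simp add: edge_def)

lemma tangent_line_edge: "tangent_line a b c l1 l2 (p i) (edge i)"
  using edge_nonzero[of i] caustics
  by unfold_locales (auto simp: has_caustics_def edge_def)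

lemma normal_components: "N i $ 1 = p (Suc i) $ 1 / a" "N i $ 2 = p (Suc i) $ 2 / b"
  "N i $ 3 = p (Suc i) $ 3 / c"
  by (simp_all add: N_def normalQ_def)

lemma ellipsoid_equation: "(p i $ 1)^2 / a + (p i $ 2)^2 / b + (p i $ 3)^2 / c = 1"
  using periodic by (simp add: periodic_traj_def billiard_traj_def confocal_def)

text \<open>Confocal quadrics intersect orthogonally, so a reflection does not affect the velocity of the
  other elliptic coordinates.\<close>

lemma mixed_normal:
  assumes "form 1 (p (Suc i)) m = 0" and "m \<noteq> 0"
  shows "mixed (p (Suc i)) (N i) m = 0"
proof -
  define x where "x = p (Suc i)"
  have nz: "a \<noteq> 0" "b \<noteq> 0" "c \<noteq> 0" using c_pos c_less_b b_less_a by auto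
  define X Y Z where "X = (x$1)^2 / a" and "Y = (x$2)^2 / b" and "Z = (x$3)^2 / c"
  have sq: "(x$1)^2 = a * X" "(x$2)^2 = b * Y" "(x$3)^2 = c * Z"
    using nz by (auto simp: X_def Y_def Z_def)
  have one: "X + Y + Z = 1"
    using ellipsoid_equation[of "Suc i"] by (simp add: X_def Y_def Z_def x_def)
  have M: "mixed x (N i) m = X * ((b-m) * (c-m)) + Y * ((a-m) * (c-m)) + Z * ((a-m) * (b-m))"
    by (simp add: mixed_def normal_components X_def Y_def Z_def power2_eq_square flip: x_def)
  have "form 1 x m = (a-m) * (b-m) * (c-m)
      - (a * X * ((b-m) * (c-m)) + b * Y * ((a-m) * (c-m)) + c * Z * ((a-m) * (b-m)))"
    by (simp add: form_def mixed_def flip: sq power2_eq_square)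
  \<comment> \<open>Writing a = (a-m) + m, and likewise for \<open>b\<close> and \<open>c\<close>,
    splits off the equation of the ellipsoid.\<close>
  also have "\<dots> = - m * mixed x (N i) m + (a-m) * (b-m) * (c-m) * (1 - (X + Y + Z))"
    unfolding M by (simp add: algebra_simps)
  finally have "m * mixed x (N i) m = 0"
    using assms(1) one by (simp add: x_def)
  then show ?thesis using assms(2) by (simp add: x_def)
qed

lemma descending_reflection:
  assumes "coordinate_range lo hi \<epsilon>"
  shows "descending lo hi \<epsilon> (p (Suc i)) (edge i) \<longleftrightarrow> descending lo hi \<epsilon> (p (Suc i)) (edge (Suc i))"
proof -
  have "\<epsilon> * mixed (p (Suc i)) (edge i) m < 0 \<longleftrightarrow> \<epsilon> * mixed (p (Suc i)) (edge (Suc i)) m < 0"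
    if "lo < m" "form 1 (p (Suc i)) m = 0" for m
  proof -
    \<comment> \<open>Both ranges lie above 0, the parameter of the ellipsoid itself.\<close>
    have "m \<noteq> 0" using that(1) assms c_order by (auto simp: coordinate_range_def)
    then have "mixed (p (Suc i)) (N i) m = 0" using mixed_normal that(2) by blast
    moreover have "vel i = vel (Suc i) + (2 * (vel i \<bullet> N i) / (N i \<bullet> N i)) *\<^sub>R N i"
      by (simp add: vel_Suc)
    ultimately have v: "mixed (p (Suc i)) (vel i) m = mixed (p (Suc i)) (vel (Suc i)) m"
      by (metis add.right_neutral mixed_add_right mixed_scale_right mult_zero_right)
    have e: "\<epsilon> * mixed (p (Suc i)) (edge j) m < 0 \<longleftrightarrow> \<epsilon> * mixed (p (Suc i)) (vel j) m < 0" for j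
    proof -
      have "mixed (p (Suc i)) (edge j) m = norm (edge j) * mixed (p (Suc i)) (vel j) m"
        by (subst edge_vel) (simp add: mixed_scale_right)
      then show ?thesis
        using edge_nonzero[of j] by (auto simp: mult_less_0_iff zero_less_mult_iff)
    qed
    show ?thesis unfolding e v ..
  qed
  then show ?thesis by (auto simp: descending_def)
qed

definition zeros :: "nat \<Rightarrow> real \<Rightarrow> real set" where
  "zeros i \<mu> = {t. 0 \<le> t \<and> t < 1 \<and> form 1 (p i + t *\<^sub>R edge i) \<mu> = 0}"

lemma hits_surf: "hits p n (surf a b c \<mu>) = (SIGMA i:{..<n}. zeros i \<mu>)"
  by (auto simp: hits_def surf_iff_form zeros_def edge_def)

lemma card_hits:
  assumes "\<And>i. finite (zeros i \<mu>)"
  shows "finite (hits p n (surf a b c \<mu>))"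
    and "card (hits p n (surf a b c \<mu>)) = (\<Sum>i<n. card (zeros i \<mu>))"
  using assms by (auto simp: hits_surf card_SigmaI)

text \<open>By \<open>descending_reflection\<close> the state at the end of an edge is the one at
  the start of the next, so the differences telescope over the period to 0.\<close>

lemma hits_range:
  assumes range: "coordinate_range lo hi \<epsilon>"
  shows "finite (hits p n (surf a b c lo))" "finite (hits p n (surf a b c hi))"
    and "card (hits p n (surf a b c lo)) = card (hits p n (surf a b c hi))"
proof -
  note tel = tangent_line.segment_zeros_telescope[OF tangent_line_edge range, folded zeros_def]
  show "finite (hits p n (surf a b c lo))" "finite (hits p n (surf a b c hi))"
    using card_hits(1) tel(1,2) by auto
  define \<sigma> :: "nat \<Rightarrow> int" where "\<sigma> i = of_bool (descending lo hi \<epsilon> (p i) (edge i))" for i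
  have "int (card (zeros i lo)) - int (card (zeros i hi)) = \<sigma> i - \<sigma> (Suc i)" for i
    using tel(3)[of i] by (simp add: \<sigma>_def descending_reflection[OF range] flip: p_Suc)
  then have "int (card (hits p n (surf a b c lo))) - int (card (hits p n (surf a b c hi)))
      = (\<Sum>i<n. \<sigma> i - \<sigma> (Suc i))"
    using tel(1,2) by (simp add: card_hits(2) flip: sum_subtractf)
  also have "\<dots> = \<sigma> 0 - \<sigma> n" by (rule sum_lessThan_telescope')
  also have "\<dots> = 0" using p_period[of 0] edge_period[of 0] by (simp add: \<sigma>_def)
  finally show "card (hits p n (surf a b c lo)) = card (hits p n (surf a b c hi))" by simp
qed

lemma hits_first_range:
  "finite (hits p n (surf a b c 0))" "card (hits p n (surf a b c 0)) = n"
  "finite (hits p n (surf a b c c1))" "card (hits p n (surf a b c c1)) = n"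
proof -
  have ends: "form 1 (p i) 0 = 0" "form 1 (p i + edge i) 0 = 0" for i
    using p_on_ellipsoid[of i] p_on_ellipsoid[of "Suc i"] by (auto simp: p_Suc)
  note ch = tangent_line.chord_zeros[OF tangent_line_edge ends, folded zeros_def]
  show "finite (hits p n (surf a b c 0))" "card (hits p n (surf a b c 0)) = n"
    using card_hits[of 0] ch(1) by auto
  show "finite (hits p n (surf a b c c1))" "card (hits p n (surf a b c c1)) = n"
    using card_hits[of c1] ch(2,3) by auto
qed

text \<open>Supplies the numbers to which the conjecture is applied.\<close>

lemma winding_numbers_exist:
  "winding_numbers a b c p n l1 l2 n (card (hits p n (surf a b c c2))) (card (hits p n (surf a b c a)))"
proof -
  have r: "coordinate_range c2 c3 1" "coordinate_range c4 a (-1)"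
    by (auto simp: coordinate_range_def)
  note H = hits_first_range hits_range[OF r(1)] hits_range[OF r(2)]
  have "finite (hits p n (surf a b c (cval a b c l1 l2 k))) \<and>
      card (hits p n (surf a b c (cval a b c l1 l2 k)))
        = [n, card (hits p n (surf a b c c2)), card (hits p n (surf a b c a))] ! j"
    if jk: "j < 3" "k = 2*j \<or> k = 2*j+1" for j k
  proof -
    have "j = 0 \<or> j = 1 \<or> j = 2" using jk(1) by auto
    then consider "j = 0" "k = 0" | "j = 0" "k = 1" | "j = 1" "k = 2" | "j = 1" "k = 3"
      | "j = 2" "k = 4" | "j = 2" "k = 5"
      using jk(2) by auto
    then show ?thesis
      using H by cases (simp_all only: cval_values, simp_all)
  qed
  then show ?thesis unfolding winding_numbers_def by blast
qed

lemma normal_component_zero: "p (Suc i) $ e = 0 \<Longrightarrow> N i $ e = 0"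
  using exhaust_3[of e] by (auto simp: normal_components)

text \<open>At a point of a coordinate plane the normal of the ellipsoid lies in that plane.\<close>

lemma edge_sign_reflection:
  assumes "p (Suc i) $ e = 0"
  shows "edge (Suc i) $ e < 0 \<longleftrightarrow> edge i $ e < 0"
proof -
  have "vel (Suc i) $ e = vel i $ e"
    using normal_component_zero[OF assms] by (simp add: vel_Suc)
  moreover have "edge j $ e < 0 \<longleftrightarrow> vel j $ e < 0" for j
    using edge_nonzero[of j] by (simp add: vel_def divide_less_0_iff)
  ultimately show ?thesis by simp
qed

lemma coordinate_nonzero: "edge i $ e \<noteq> 0 \<or> p i $ e \<noteq> 0"
  using tangent_line.coordinate_nonzero[OF tangent_line_edge, of i] exhaust_3[of e] by auto

text \<open>Modulo 2 the hits on an edge are the change of side, and the changes sum to 0 over a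
  period.\<close>

lemma even_plane_hits:
  assumes plane: "\<And>x. form 1 x \<mu> = 0 \<longleftrightarrow> x $ e = 0"
  shows "even (card (hits p n (surf a b c \<mu>)))"
proof -
  define \<sigma> :: "nat \<Rightarrow> int" where "\<sigma> i = of_bool (p i $ e > 0 \<or> (p i $ e = 0 \<and> edge i $ e < 0))" for i
  have z: "zeros i \<mu> = {t. 0 \<le> t \<and> t < 1 \<and> edge i $ e * t + p i $ e = 0}" for i
    by (auto simp: zeros_def plane algebra_simps)
  have fin: "finite (zeros i \<mu>)" for i
    unfolding z using affine_zeros_unit_interval(1) coordinate_nonzero by blast
  have "even (int (card (zeros i \<mu>)) - (\<sigma> i - \<sigma> (Suc i)))" for i
  proof -
    have "\<sigma> (Suc i) = of_bool (p (Suc i) $ e > 0 \<or> (p (Suc i) $ e = 0 \<and> edge i $ e < 0))"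
      using edge_sign_reflection[of i e] by (auto simp: \<sigma>_def)
    then show ?thesis
      using card_affine_zeros_parity[OF coordinate_nonzero, of i e] by (simp add: z \<sigma>_def p_Suc)
  qed
  then have "even (\<Sum>i<n. int (card (zeros i \<mu>)) - (\<sigma> i - \<sigma> (Suc i)))"
    by (intro dvd_sum) auto
  moreover have "(\<Sum>i<n. \<sigma> i - \<sigma> (Suc i)) = \<sigma> 0 - \<sigma> n" by (rule sum_lessThan_telescope')
  moreover have "\<sigma> n = \<sigma> 0" using p_period[of 0] edge_period[of 0] by (simp add: \<sigma>_def)
  ultimately have "even (\<Sum>i<n. int (card (zeros i \<mu>)))" by (simp add: sum_subtractf)
  then show ?thesis by (simp add: card_hits(2)[OF fin] flip: of_nat_sum)
qed

text \<open>Polarization: for both ends on the ellipsoid, twice the product of edge and normal is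
  the quadratic form of the ellipsoid at the edge.\<close>

lemma vel_outward: "vel i \<bullet> N i > 0"
proof -
  define x y where "x = p i" and "y = p (Suc i)"
  have abc: "a > 0" "b > 0" "c > 0" using c_pos c_less_b b_less_a by auto
  have "2 * (edge i \<bullet> N i) = (edge i $ 1)^2 / a + (edge i $ 2)^2 / b + (edge i $ 3)^2 / c
      + ((y$1)^2/a + (y$2)^2/b + (y$3)^2/c) - ((x$1)^2/a + (x$2)^2/b + (x$3)^2/c)"
    using abc
    by (simp add: inner_vec_def sum_3 normal_components edge_def x_def y_def field_simps power2_eq_square)
  also have "\<dots> = (edge i $ 1)^2 / a + (edge i $ 2)^2 / b + (edge i $ 3)^2 / c"
    using ellipsoid_equation[of i] ellipsoid_equation[of "Suc i"] by (simp add: x_def y_def)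
  also have "\<dots> > 0"
    using edge_nonzero[of i] abc
    by (auto simp: vec_eq_iff forall_3 add_pos_nonneg add_nonneg_pos)
  finally show ?thesis using edge_nonzero[of i] by (simp add: vel_def)
qed

text \<open>If the trajectory stayed on one side of the plane x = 0, every reflection would bend its
  velocity towards that plane, contradicting periodicity.\<close>

lemma crosses_first_plane: "card (hits p n (surf a b c a)) > 0"
proof (rule ccontr)
  assume "\<not> ?thesis"
  moreover have "finite (hits p n (surf a b c a))"
    using hits_range(2)[of c4 a "-1"] by (simp add: coordinate_range_def)
  ultimately have "hits p n (surf a b c a) = {}" by simp
  then have none: "zeros i a = {}" if "i < n" for i using that by (auto simp: hits_surf)
  have z: "zeros i a = {t. 0 \<le> t \<and> t < 1 \<and> edge i $ 1 * t + p i $ 1 = 0}" for i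
    by (auto simp: zeros_def form_at_axes_zero algebra_simps)
  \<comment> \<open>The product may be 0, as the end of an edge is not counted; \<open>ne\<close>
    then excludes this, using \<open>p n = p 0\<close> at the last vertex.\<close>
  have step: "p i $ 1 \<noteq> 0 \<and> p i $ 1 * p (Suc i) $ 1 \<ge> 0" if "i < n" for i
  proof -
    have "card (zeros i a) = 0" using none[OF that] by simp
    then show ?thesis
      unfolding z affine_zeros_unit_interval(2)[OF coordinate_nonzero, of i 1]
      by (auto simp: p_Suc add.commute not_less split: if_splits)
  qed
  have ne: "p i $ 1 \<noteq> 0" if "i \<le> n" for i
    using step[of i] step[of 0] n_pos p_period[of 0] that by (cases "i = n") auto
  have same: "p 0 $ 1 * p i $ 1 > 0" if "i \<le> n" for i
    using that
  proof (induction i)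
    case 0
    then show ?case using ne[of 0] by (auto simp: zero_less_mult_iff)
  next
    case (Suc i)
    then show ?case
      using step[of i] ne[of "Suc i"] ne[of i]
      by (auto simp: zero_less_mult_iff zero_le_mult_iff)
  qed
  \<comment> \<open>A reflection subtracts a positive multiple of the outward normal, whose first
    component has the sign of that of \<open>p 0\<close>.\<close>
  have dec: "p 0 $ 1 * vel (Suc i) $ 1 < p 0 $ 1 * vel i $ 1" if "i < n" for i
  proof -
    have "N i \<noteq> 0" using vel_outward[of i] by auto
    then have "2 * (vel i \<bullet> N i) / (N i \<bullet> N i) > 0" using vel_outward[of i] by simp
    moreover have "p 0 $ 1 * N i $ 1 > 0"
      using same[of "Suc i"] that c_pos c_less_b b_less_a
      by (simp add: normal_components)
    ultimately have "2 * (vel i \<bullet> N i) / (N i \<bullet> N i) * (p 0 $ 1 * N i $ 1) > 0" by (rule mult_pos_pos)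
    then show ?thesis by (simp add: vel_Suc algebra_simps)
  qed
  have "p 0 $ 1 * vel i $ 1 < p 0 $ 1 * vel 0 $ 1" if "0 < i" "i \<le> n" for i
    using that
  proof (induction i)
    case (Suc i)
    then show ?case using dec[of i] by (cases "i = 0") auto
  qed simp
  from this[of n] show False using n_pos edge_period[of 0] by (simp add: vel_def)
qed

end

section \<open>Lower bounds for the period in the four types\<close>

theorem theorem1:
  fixes a b c :: real
  assumes "0 < c" and "c < b" and "b < a"
    and conj: "\<forall>p n l1 l2 m0 m1 m2.
        periodic_traj a b c p n \<and> has_caustics a b c p l1 l2 \<and> nonsingular a b c l1 l2 \<and>
        winding_numbers a b c p n l1 l2 m0 m1 m2 \<longrightarrow> m2 < m1 \<and> m1 < m0"
  shows "\<forall>p n l1 l2. periodic_traj a b c p n \<and> has_caustics a b c p l1 l2 \<longrightarrow>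
        (type_EH1 a b c l1 l2 \<longrightarrow> 5 \<le> n) \<and>
        (type_H1H1 a b c l1 l2 \<longrightarrow> 4 \<le> n) \<and>
        (type_EH2 a b c l1 l2 \<longrightarrow> 5 \<le> n) \<and>
        (type_H1H2 a b c l1 l2 \<longrightarrow> 6 \<le> n)"
proof (intro allI impI)
  fix p n l1 l2
  assume A: "periodic_traj a b c p n \<and> has_caustics a b c p l1 l2"
  have l12: "l1 < l2" using A by (simp add: has_caustics_def)
  have bounds: "(l1 < c \<longrightarrow> 5 \<le> n) \<and> (c < l1 \<longrightarrow> 4 \<le> n) \<and> (c < l1 \<and> b < l2 \<longrightarrow> 6 \<le> n)"
    if l: "0 < l1" "l1 < b" "c < l2" "l2 < a" "l1 \<noteq> c" "l2 \<noteq> b"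
  proof -
    interpret caustic_trajectory a b c l1 l2 p n
      using A assms l l12 by unfold_locales auto
    define m1 m2 where "m1 = card (hits p n (surf a b c c2))" and "m2 = card (hits p n (surf a b c a))"
    have "nonsingular a b c l1 l2" using assms l l12 by (auto simp: nonsingular_def)
    then have ord: "m2 < m1" "m1 < n"
      using conj A winding_numbers_exist unfolding m1_def m2_def by blast+
    have "even m2" unfolding m2_def by (rule even_plane_hits) (rule form_at_axes_zero)
    moreover have "m2 > 0" using crosses_first_plane by (simp add: m2_def)
    ultimately have m2: "m2 \<ge> 2" by presburger
    have ec: "even (card (hits p n (surf a b c c)))" and eb: "even (card (hits p n (surf a b c b)))"
      by (rule even_plane_hits, rule form_at_axes_zero)+
    \<comment> \<open>\<open>c\<close> is \<open>c2\<close> if \<open>l1 < c\<close> and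
      \<open>c1\<close> if \<open>c < l1\<close>; \<open>b\<close> is \<open>c3\<close> if
      \<open>b < l2\<close>. An even \<open>m1 > 2\<close> is at least 4, so \<open>n\<close> is at
      least 5, and at least 6 if also even; an even \<open>n > m1 > 2\<close> is at least 4.\<close>
    have "even m1" if "l1 < c" using ec that by (simp add: m1_def c2_def max_def)
    moreover have "even n" if "c < l1"
      using ec that hits_first_range(4) by (simp add: c1_def min_def)
    moreover have "even m1" if "b < l2"
      using eb that hits_range(3)[of c2 c3 1] by (simp add: m1_def coordinate_range_def c3_def min_def)
    ultimately show ?thesis
      using ord m2 by (cases "l1 < c"; cases "c < l1"; cases "b < l2"; simp; presburger)
  qed
  show "(type_EH1 a b c l1 l2 \<longrightarrow> 5 \<le> n) \<and> (type_H1H1 a b c l1 l2 \<longrightarrow> 4 \<le> n) \<and>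
      (type_EH2 a b c l1 l2 \<longrightarrow> 5 \<le> n) \<and> (type_H1H2 a b c l1 l2 \<longrightarrow> 6 \<le> n)"
    using bounds assms(1-3)
    by (auto simp: type_EH1_def type_H1H1_def type_EH2_def type_H1H2_def)
qed

end
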